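(* A consequence relation $\mathrel{|\!\sim}$ (a binary relation on the set $\mathcal{L}(M)$ of compound attributes over a set $M$ of attributes) is preferential if and only if it can be induced by some preferential context $\mathbb{P}=(G,M,I,\prec)$, i.e. $\mathrel{|\!\sim}$ equals $\mathrel{|\!\sim}_{\mathbb{P}}$ for some preferential context $\mathbb{P}$.
   Context: The language $\mathcal{L}(M)$ of compound attributes is generated from the attributes $m\in M$ by $\neg,\land,\lor$ (so compound attributes correspond to propositional formulae with atoms in $M$). A consequence relation $\mathrel{|\!\sim}$ is preferential if for all $\phi,\psi,\gamma$: (REF) $\phi\mathrel{|\!\sim}\phi$; (LLE) if $\phi\equiv\psi$ and $\psi\mathrel{|\!\sim}\gamma$, then $\phi\mathrel{|\!\sim}\gamma$; (RW) if $\psi\rightarrow\gamma$ and $\phi\mathrel{|\!\sim}\psi$, then $\phi\mathrel{|\!\sim}\gamma$; (AND) if $\phi\mathrel{|\!\sim}\psi$ and $\phi\mathrel{|\!\sim}\gamma$, then $\phi\mathrel{|\!\sim}\psi\land\gamma$; (OR) if $\phi\mathrel{|\!\sim}\gamma$ and $\psi\mathrel{|\!\sim}\gamma$, then $\phi\lor\psi\mathrel{|\!\sim}\gamma$; (CUT) if $\phi\land\psi\mathrel{|\!\sim}\gamma$ and $\phi\mathrel{|\!\sim}\psi$, then $\phi\mathrel{|\!\sim}\gamma$; (CM) if $\phi\mathrel{|\!\sim}\psi$ and $\phi\mathrel{|\!\sim}\gamma$, then $\phi\land\psi\mathrel{|\!\sim}\gamma$. Here $\equiv$ is logical equivalence and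 $\rightarrow$ is implication of the underlying logic; relative to a given context (as defined next), $\phi\equiv\psi$ is read as $\phi^\downarrow=\psi^\downarrow$ and $\phi\rightarrow\psi$ as $\phi^\downarrow\subseteq\psi^\downarrow$. A preferential context is $\mathbb{P}=(G,M,I,\prec)$ with $G$ a set of objects, $M$ a set of attributes, $I\subseteq G\times M$, and $\prec$ a strict partial order on $G$. Extents $\phi^\downarrow\subseteq G$ of $\phi\in\mathcal{L}(M)$: $m^\downarrow=\{g\in G\mid (g,m)\in I\}$, $(\neg\phi)^\downarrow=G\setminus\phi^\downarrow$, $(\phi\land\psi)^\downarrow=\phi^\downarrow\cap\psi^\downarrow$, $(\phi\lor\psi)^\downarrow=\phi^\downarrow\cup\psi^\downarrow$. For $B\subseteq G$ let $\underline{B}=\{g\in B\mid \nexists h\in B,\ h\prec g\}$. The induced relation is: $\phi\mathrel{|\!\sim}_{\mathbb{P}}\psi$ iff $\underline{\phi^\downarrow}\subseteq\psi^\downarrow$.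
   Formalization: The preferential contexts are additionally required to be smooth (each object in an extent is minimal there or lies above a minimal one); without this, a context with an infinite descending chain of objects can violate (CM). Finite contexts are always smooth. *)

theory Defs
  imports Main
begin

datatype 'm compound =
    Attr 'm
  | Neg "'m compound"
  | And "'m compound" "'m compound"
  | Or "'m compound" "'m compound"

definition lang :: "'m set \<Rightarrow> 'm compound set"
  where "lang M = {\<phi>. set_compound \<phi> \<subseteq> M}"

text \<open>The underlying logic is classical propositional logic; a valuation is given by the set
  of attributes it makes true.\<close>

primrec sat :: "'m set \<Rightarrow> 'm compound \<Rightarrow> bool"
  where
    "sat v (Attr m) \<longleftrightarrow> m \<in> v"
  | "sat v (Neg \<phi>) \<longleftrightarrow> \<not> sat v \<phi>"
  | "sat v (And \<phi> \<psi>) \<longleftrightarrow> sat v \<phi> \<and> sat v \<psi>"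
  | "sat v (Or \<phi> \<psi>) \<longleftrightarrow> sat v \<phi> \<or> sat v \<psi>"

definition prop_implies :: "'m compound \<Rightarrow> 'm compound \<Rightarrow> bool"
  where "prop_implies \<phi> \<psi> \<longleftrightarrow> (\<forall>v. sat v \<phi> \<longrightarrow> sat v \<psi>)"

text \<open>The parameter \<open>imp\<close> is the implication of the underlying logic, so that the equivalence
  in (LLE) is implication in both directions. The conjuncts are, in this order,
  (REF), (LLE), (RW), (AND), (OR), (CUT), (CM).\<close>

definition preferential ::
    "('m compound \<Rightarrow> 'm compound \<Rightarrow> bool) \<Rightarrow> 'm set \<Rightarrow> ('m compound \<times> 'm compound) set \<Rightarrow> bool"
  where "preferential imp M R \<longleftrightarrow>
    (\<forall>\<phi> \<in> lang M. (\<phi>, \<phi>) \<in> R) \<and>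
    (\<forall>\<phi> \<in> lang M. \<forall>\<psi> \<in> lang M. \<forall>\<gamma> \<in> lang M.
      imp \<phi> \<psi> \<and> imp \<psi> \<phi> \<and> (\<psi>, \<gamma>) \<in> R \<longrightarrow> (\<phi>, \<gamma>) \<in> R) \<and>
    (\<forall>\<phi> \<in> lang M. \<forall>\<psi> \<in> lang M. \<forall>\<gamma> \<in> lang M.
      imp \<psi> \<gamma> \<and> (\<phi>, \<psi>) \<in> R \<longrightarrow> (\<phi>, \<gamma>) \<in> R) \<and>
    (\<forall>\<phi> \<in> lang M. \<forall>\<psi> \<in> lang M. \<forall>\<gamma> \<in> lang M.
      (\<phi>, \<psi>) \<in> R \<and> (\<phi>, \<gamma>) \<in> R \<longrightarrow> (\<phi>, And \<psi> \<gamma>) \<in> R) \<and>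
    (\<forall>\<phi> \<in> lang M. \<forall>\<psi> \<in> lang M. \<forall>\<gamma> \<in> lang M.
      (\<phi>, \<gamma>) \<in> R \<and> (\<psi>, \<gamma>) \<in> R \<longrightarrow> (Or \<phi> \<psi>, \<gamma>) \<in> R) \<and>
    (\<forall>\<phi> \<in> lang M. \<forall>\<psi> \<in> lang M. \<forall>\<gamma> \<in> lang M.
      (And \<phi> \<psi>, \<gamma>) \<in> R \<and> (\<phi>, \<psi>) \<in> R \<longrightarrow> (\<phi>, \<gamma>) \<in> R) \<and>
    (\<forall>\<phi> \<in> lang M. \<forall>\<psi> \<in> lang M. \<forall>\<gamma> \<in> lang M.
      (\<phi>, \<psi>) \<in> R \<and> (\<phi>, \<gamma>) \<in> R \<longrightarrow> (And \<phi> \<psi>, \<gamma>) \<in> R)"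

text \<open>In the order \<open>prec\<close>, a pair \<open>(h, g)\<close> means that \<open>h\<close> is preferred to (smaller than) \<open>g\<close>.\<close>

definition preferential_context ::
    "'g set \<Rightarrow> 'm set \<Rightarrow> ('g \<times> 'm) set \<Rightarrow> ('g \<times> 'g) set \<Rightarrow> bool"
  where "preferential_context G M I prec \<longleftrightarrow>
    I \<subseteq> G \<times> M \<and> prec \<subseteq> G \<times> G \<and> irrefl prec \<and> trans prec"

primrec extent :: "'g set \<Rightarrow> ('g \<times> 'm) set \<Rightarrow> 'm compound \<Rightarrow> 'g set"
  where
    "extent G I (Attr m) = {g \<in> G. (g, m) \<in> I}"
  | "extent G I (Neg \<phi>) = G - extent G I \<phi>"
  | "extent G I (And \<phi> \<psi>) = extent G I \<phi> \<inter> extent G I \<psi>"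
  | "extent G I (Or \<phi> \<psi>) = extent G I \<phi> \<union> extent G I \<psi>"

definition ctx_implies ::
    "'g set \<Rightarrow> ('g \<times> 'm) set \<Rightarrow> 'm compound \<Rightarrow> 'm compound \<Rightarrow> bool"
  where "ctx_implies G I \<phi> \<psi> \<longleftrightarrow> extent G I \<phi> \<subseteq> extent G I \<psi>"

definition minimal :: "('g \<times> 'g) set \<Rightarrow> 'g set \<Rightarrow> 'g set"
  where "minimal prec B = {g \<in> B. \<not> (\<exists>h \<in> B. (h, g) \<in> prec)}"

definition induced ::
    "'g set \<Rightarrow> 'm set \<Rightarrow> ('g \<times> 'm) set \<Rightarrow> ('g \<times> 'g) set \<Rightarrow> ('m compound \<times> 'm compound) set"
  where "induced G M I prec =
    {(\<phi>, \<psi>). \<phi> \<in> lang M \<and> \<psi> \<in> lang M \<and> minimal prec (extent G I \<phi>) \<subseteq> extent G I \<psi>}"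

text \<open>The smoothness condition of Kraus, Lehmann and Magidor. It holds in every context with
  finitely many objects (\<open>finite_imp_smooth\<close>), but without it an infinite context may violate (CM)
  (\<open>induced_not_preferential\<close>).\<close>

definition smooth :: "'g set \<Rightarrow> 'm set \<Rightarrow> ('g \<times> 'm) set \<Rightarrow> ('g \<times> 'g) set \<Rightarrow> bool"
  where "smooth G M I prec \<longleftrightarrow>
    (\<forall>\<phi> \<in> lang M. \<forall>g \<in> extent G I \<phi>.
      g \<in> minimal prec (extent G I \<phi>) \<or>
      (\<exists>h \<in> minimal prec (extent G I \<phi>). (h, g) \<in> prec))"

lemma extent_subset: "extent G I \<phi> \<subseteq> G"
  by (induction \<phi>) auto

lemma finite_imp_smooth:
  assumes "preferential_context G M I prec" and "finite G"
  shows "smooth G M I prec"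
  unfolding smooth_def
proof (intro ballI)
  fix \<phi> g assume g: "g \<in> extent G I \<phi>"
  let ?E = "extent G I \<phi>"
  have tr: "trans prec" and ir: "irrefl prec" and sub: "prec \<subseteq> G \<times> G"
    using assms(1) by (auto simp: preferential_context_def)
  have "finite prec"
    using sub assms(2) by (meson finite_SigmaI finite_subset)
  moreover have "acyclic prec"
    using tr ir by (simp add: acyclic_irrefl)
  ultimately have wf: "wf prec"
    by (rule finite_acyclic_wf)
  show "g \<in> minimal prec ?E \<or> (\<exists>h \<in> minimal prec ?E. (h, g) \<in> prec)"
  proof (cases "g \<in> minimal prec ?E")
    case False
    let ?Q = "{h \<in> ?E. (h, g) \<in> prec}"
    from False g obtain h0 where "h0 \<in> ?Q"
      by (auto simp: minimal_def)
    then obtain h where h: "h \<in> ?Q" and m: "\<And>y. (y, h) \<in> prec \<Longrightarrow> y \<notin> ?Q"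
      by (rule wfE_min [OF wf]) blast
    have "h \<in> minimal prec ?E"
      using h m transD [OF tr, of _ h g] unfolding minimal_def by blast
    with h show ?thesis by blast
  qed simp
qed

lemma induced_not_preferential:
  "\<exists>(G :: nat set) (M :: unit set) I prec.
     preferential_context G M I prec \<and> \<not> preferential prop_implies M (induced G M I prec)"
proof (intro exI conjI)
  let ?G = "UNIV :: nat set" and ?M = "{()}" and ?I = "{(0 :: nat, ())}"
  let ?prec = "{(h, g). g < h} :: (nat \<times> nat) set"
  show "preferential_context ?G ?M ?I ?prec"
    by (auto simp: preferential_context_def irrefl_def trans_def)
  let ?a = "Attr ()"
  let ?t = "Or ?a (Neg ?a)"
  have L: "\<phi> \<in> lang ?M" for \<phi> :: "unit compound"
    by (auto simp: lang_def)
  have t: "extent ?G ?I ?t = UNIV" by auto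
  have "minimal ?prec UNIV = {}"
    by (auto simp: minimal_def)
  then have 1: "(?t, \<psi>) \<in> induced ?G ?M ?I ?prec" for \<psi>
    unfolding induced_def by (simp only: L t mem_Collect_eq prod.case empty_subsetI simp_thms)
  have 2: "(And ?t ?a, Neg ?a) \<notin> induced ?G ?M ?I ?prec"
    by (auto simp: induced_def minimal_def)
  show "\<not> preferential prop_implies ?M (induced ?G ?M ?I ?prec)"
  proof
    assume "preferential prop_implies ?M (induced ?G ?M ?I ?prec)"
    then have "\<forall>\<phi> \<in> lang ?M. \<forall>\<psi> \<in> lang ?M. \<forall>\<gamma> \<in> lang ?M.
        (\<phi>, \<psi>) \<in> induced ?G ?M ?I ?prec \<and> (\<phi>, \<gamma>) \<in> induced ?G ?M ?I ?prec \<longrightarrow>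
        (And \<phi> \<psi>, \<gamma>) \<in> induced ?G ?M ?I ?prec"
      unfolding preferential_def by (elim conjE)
    then have "(And ?t ?a, Neg ?a) \<in> induced ?G ?M ?I ?prec"
      using 1 L by blast
    with 2 show False by simp
  qed
qed

end

theory Submission
  imports Defs
begin

text \<open>For soundness, smoothness is needed only for (CM). For completeness, take as objects the pairs
  \<open>(v, \<alpha>)\<close> where the valuation \<open>v\<close> is normal for \<open>\<alpha>\<close>, that is, satisfies every consequence of
  \<open>\<alpha>\<close>; put \<open>(v, \<alpha>)\<close> below \<open>(w, \<beta>)\<close> iff \<open>\<alpha> \<or> \<beta>\<close> has \<open>\<alpha>\<close> as a consequence and \<open>v\<close> falsifies \<open>\<beta>\<close>. The
  minimal objects satisfying \<open>\<alpha>\<close> turn out to be the pairs \<open>(v, \<beta>)\<close> such that \<open>v\<close> satisfies \<open>\<alpha>\<close> and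
  \<open>\<alpha> \<or> \<beta>\<close> has \<open>\<beta>\<close> as a consequence; their valuations are exactly those normal for \<open>\<alpha>\<close>. By
  compactness, the consequences of \<open>\<alpha>\<close> are the formulae true under all valuations normal for \<open>\<alpha>\<close>.\<close>

lemma lang_simps [simp]:
  "Attr m \<in> lang M \<longleftrightarrow> m \<in> M"
  "Neg \<phi> \<in> lang M \<longleftrightarrow> \<phi> \<in> lang M"
  "And \<phi> \<psi> \<in> lang M \<longleftrightarrow> \<phi> \<in> lang M \<and> \<psi> \<in> lang M"
  "Or \<phi> \<psi> \<in> lang M \<longleftrightarrow> \<phi> \<in> lang M \<and> \<psi> \<in> lang M"
  by (auto simp: lang_def)

text \<open>The row of an object serves as its valuation, so propositional implication carries over
  to every context.\<close>

lemma extent_eq_sat: "extent G I \<phi> = {g \<in> G. sat {m. (g, m) \<in> I} \<phi>}"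
  by (induction \<phi>) auto

section \<open>Soundness\<close>

lemma prop_implies_imp_ctx_implies: "prop_implies \<phi> \<psi> \<Longrightarrow> ctx_implies G I \<phi> \<psi>"
  by (auto simp: prop_implies_def ctx_implies_def extent_eq_sat)

text \<open>Implication occurs only in premises, in (LLE) and (RW), so fewer implications ask for
  less.\<close>

lemma preferential_antimono:
  assumes "preferential imp M R" and "\<And>\<phi> \<psi>. imp' \<phi> \<psi> \<Longrightarrow> imp \<phi> \<psi>"
  shows "preferential imp' M R"
  using assms unfolding preferential_def by meson

lemma minimal_Un: "minimal prec (A \<union> B) \<subseteq> minimal prec A \<union> minimal prec B"
  by (auto simp: minimal_def)

lemma smooth_imp_preferential_induced:
  assumes "smooth G M I prec"
  shows "preferential (ctx_implies G I) M (induced G M I prec)"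
proof -
  have CM: "minimal prec (extent G I \<phi> \<inter> extent G I \<psi>) \<subseteq> extent G I \<gamma>"
    if "\<phi> \<in> lang M" "minimal prec (extent G I \<phi>) \<subseteq> extent G I \<psi>"
      "minimal prec (extent G I \<phi>) \<subseteq> extent G I \<gamma>" for \<phi> \<psi> \<gamma>
  proof
    fix g assume g: "g \<in> minimal prec (extent G I \<phi> \<inter> extent G I \<psi>)"
    then have "g \<in> extent G I \<phi>" by (simp add: minimal_def)
    with assms that(1)
    consider "g \<in> minimal prec (extent G I \<phi>)"
      | h where "h \<in> minimal prec (extent G I \<phi>)" "(h, g) \<in> prec"
      unfolding smooth_def by blast
    then show "g \<in> extent G I \<gamma>"
    proof cases
      case 2
      \<comment> \<open>Minimal in the extent of \<open>\<phi>\<close>, \<open>h\<close> lies in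
        that of \<open>\<psi>\<close> too, against the minimality of \<open>g\<close> in the
        intersection.\<close>
      with that(2) have "h \<in> extent G I \<phi> \<inter> extent G I \<psi>" by (auto simp: minimal_def)
      with g 2 show ?thesis by (auto simp: minimal_def)
    qed (use that in blast)
  qed
  have CUT: "minimal prec A \<subseteq> C" if "minimal prec (A \<inter> B) \<subseteq> C" "minimal prec A \<subseteq> B" for A B C
    using that by (auto simp: minimal_def)
  have REF: "minimal prec A \<subseteq> A" for A by (auto simp: minimal_def)
  show ?thesis
    unfolding preferential_def
  proof (intro conjI)
    show "\<forall>\<phi>\<in>lang M. \<forall>\<psi>\<in>lang M. \<forall>\<gamma>\<in>lang M.
        (\<phi>, \<gamma>) \<in> induced G M I prec \<and> (\<psi>, \<gamma>) \<in> induced G M I prec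
          \<longrightarrow> (Or \<phi> \<psi>, \<gamma>) \<in> induced G M I prec"
      using minimal_Un[of prec] by (fastforce simp: induced_def)
    show "\<forall>\<phi>\<in>lang M. \<forall>\<psi>\<in>lang M. \<forall>\<gamma>\<in>lang M.
        (And \<phi> \<psi>, \<gamma>) \<in> induced G M I prec \<and> (\<phi>, \<psi>) \<in> induced G M I prec
          \<longrightarrow> (\<phi>, \<gamma>) \<in> induced G M I prec"
      using CUT by (simp add: induced_def) blast
  qed (use REF CM in \<open>auto simp: induced_def ctx_implies_def\<close>)
qed

corollary smooth_imp_preferential_prop_implies:
  "smooth G M I prec \<Longrightarrow> preferential prop_implies M (induced G M I prec)"
  by (rule preferential_antimono[OF smooth_imp_preferential_induced prop_implies_imp_ctx_implies])

section \<open>Compactness\<close>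

text \<open>A filter of the Lindenbaum algebra of \<open>lang M\<close>, possibly improper.\<close>

definition deductive_theory :: "'m set \<Rightarrow> 'm compound set \<Rightarrow> bool"
  where "deductive_theory M F \<longleftrightarrow> F \<subseteq> lang M \<and> F \<noteq> {} \<and> (\<forall>\<phi>\<in>F. \<forall>\<psi>\<in>F. And \<phi> \<psi> \<in> F) \<and>
    (\<forall>\<phi>\<in>F. \<forall>\<psi>\<in>lang M. prop_implies \<phi> \<psi> \<longrightarrow> \<psi> \<in> F)"

lemma deductive_theory_consequence:
  assumes "deductive_theory M F" "\<phi> \<in> F" "\<psi> \<in> F" "\<gamma> \<in> lang M"
    and "\<And>v. sat v \<phi> \<Longrightarrow> sat v \<psi> \<Longrightarrow> sat v \<gamma>"
  shows "\<gamma> \<in> F"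
proof -
  have "And \<phi> \<psi> \<in> F" using assms(1-3) by (simp add: deductive_theory_def)
  moreover have "prop_implies (And \<phi> \<psi>) \<gamma>" using assms(5) by (simp add: prop_implies_def)
  ultimately show ?thesis using assms(1,4) unfolding deductive_theory_def by blast
qed

text \<open>By Zorn's lemma. Maximality is taken among the theories omitting \<open>\<beta>\<close>,
  so that the valuation read off later falsifies \<open>\<beta>\<close> itself.\<close>

lemma deductive_theory_maximal_exists:
  assumes F: "deductive_theory M F" "\<beta> \<notin> F"
  obtains T where "F \<subseteq> T" "deductive_theory M T" "\<beta> \<notin> T"
    "\<And>S. deductive_theory M S \<Longrightarrow> \<beta> \<notin> S \<Longrightarrow> T \<subseteq> S \<Longrightarrow> S = T"
proof -
  let ?A = "{T. F \<subseteq> T \<and> deductive_theory M T \<and> \<beta> \<notin> T}"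
  have "\<exists>T\<in>?A. \<forall>S\<in>?A. T \<subseteq> S \<longrightarrow> S = T"
  proof (rule subset_Zorn_nonempty)
    show "?A \<noteq> {}" using F by blast
  next
    fix C assume C: "C \<noteq> {}" "subset.chain ?A C"
    then have th: "F \<subseteq> T" "deductive_theory M T" "\<beta> \<notin> T" if "T \<in> C" for T
      using that by (auto simp: subset_chain_def)
    have "And \<phi> \<psi> \<in> \<Union>C" if "\<phi> \<in> \<Union>C" "\<psi> \<in> \<Union>C" for \<phi> \<psi>
    proof -
      from that obtain S T where "S \<in> C" "\<phi> \<in> S" "T \<in> C" "\<psi> \<in> T" by blast
      moreover from this have "S \<subseteq> T \<or> T \<subseteq> S"
        using C by (auto simp: subset_chain_def)
      ultimately obtain U where "U \<in> C" "\<phi> \<in> U" "\<psi> \<in> U" by blast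
      with th(2) show ?thesis by (auto simp: deductive_theory_def)
    qed
    moreover have "\<Union>C \<subseteq> lang M" using th(2) by (simp add: deductive_theory_def Sup_le_iff)
    moreover have "\<Union>C \<noteq> {}" using C(1) th(2) by (fastforce simp: deductive_theory_def)
    moreover have "\<psi> \<in> \<Union>C" if "\<phi> \<in> \<Union>C" "\<psi> \<in> lang M" "prop_implies \<phi> \<psi>" for \<phi> \<psi>
      using that th(2) unfolding deductive_theory_def by blast
    ultimately have "deductive_theory M (\<Union>C)" unfolding deductive_theory_def by blast
    then show "\<Union>C \<in> ?A" using C(1) th by blast
  qed
  then obtain T where "T \<in> ?A" and "\<forall>S\<in>?A. T \<subseteq> S \<longrightarrow> S = T" ..
  then show thesis by (intro that[of T]) auto
qed

text \<open>\<open>S\<close> is the theory generated by \<open>F\<close> and \<open>\<phi>\<close>;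
  a single premise from \<open>F\<close> suffices because \<open>F\<close> is closed under
  conjunction.\<close>

lemma deductive_theory_adjoin:
  assumes F: "deductive_theory M F" and \<phi>: "\<phi> \<in> lang M"
  defines "S \<equiv> {\<chi> \<in> lang M. \<exists>f\<in>F. prop_implies (And f \<phi>) \<chi>}"
  shows "deductive_theory M S" "F \<subseteq> S" "\<phi> \<in> S"
proof -
  obtain f0 where f0: "f0 \<in> F" using F by (auto simp: deductive_theory_def)
  show \<phi>S: "\<phi> \<in> S" using f0 \<phi> by (auto simp: S_def prop_implies_def)
  show "F \<subseteq> S" using F by (auto simp: S_def prop_implies_def deductive_theory_def)
  have "And \<chi> \<psi> \<in> S" if "\<chi> \<in> S" "\<psi> \<in> S" for \<chi> \<psi>
  proof -
    from that obtain f g where fg: "f \<in> F" "g \<in> F" "prop_implies (And f \<phi>) \<chi>"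
        "prop_implies (And g \<phi>) \<psi>" "\<chi> \<in> lang M" "\<psi> \<in> lang M"
      by (auto simp: S_def)
    have "And f g \<in> F" using F fg(1,2) by (simp add: deductive_theory_def)
    moreover have "prop_implies (And (And f g) \<phi>) (And \<chi> \<psi>)"
      using fg(3,4) by (simp add: prop_implies_def)
    ultimately show ?thesis using fg(5,6) unfolding S_def by auto
  qed
  moreover have "\<psi> \<in> S" if "\<chi> \<in> S" "\<psi> \<in> lang M" "prop_implies \<chi> \<psi>" for \<chi> \<psi>
    using that by (auto simp: S_def prop_implies_def)
  ultimately show "deductive_theory M S" using \<phi>S by (auto simp: deductive_theory_def S_def)
qed

text \<open>Compactness as the prime filter theorem: a theory maximal among those omitting
  \<open>\<beta>\<close> decides every formula, so membership in it is truth under the valuation of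
  its atoms.\<close>

lemma deductive_theory_separation:
  assumes F: "deductive_theory M F" "\<beta> \<notin> F" and \<beta>: "\<beta> \<in> lang M"
  obtains v where "v \<subseteq> M" "\<And>\<phi>. \<phi> \<in> F \<Longrightarrow> sat v \<phi>" "\<not> sat v \<beta>"
proof -
  obtain T where T: "F \<subseteq> T" "deductive_theory M T" "\<beta> \<notin> T"
    and max: "\<And>S. deductive_theory M S \<Longrightarrow> \<beta> \<notin> S \<Longrightarrow> T \<subseteq> S \<Longrightarrow> S = T"
    using deductive_theory_maximal_exists[OF F] by blast
  have sub: "T \<subseteq> lang M" using T(2) by (simp add: deductive_theory_def)
  note cons = deductive_theory_consequence[OF T(2)]
  \<comment> \<open>By maximality, adjoining \<open>\<phi>\<close> to \<open>T\<close> must yield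
    \<open>\<beta>\<close>.\<close>
  have refutation: "\<exists>f\<in>T. prop_implies (And f \<phi>) \<beta>" if "\<phi> \<in> lang M" "\<phi> \<notin> T" for \<phi>
    using max[OF deductive_theory_adjoin(1)[OF T(2) that(1)]] deductive_theory_adjoin(2,3)[OF T(2) that(1)] that(2)
    by blast
  have neg: "Neg \<phi> \<in> T \<longleftrightarrow> \<phi> \<notin> T" if \<phi>: "\<phi> \<in> lang M" for \<phi>
  proof
    assume "Neg \<phi> \<in> T"
    then show "\<phi> \<notin> T" using cons[of \<phi> "Neg \<phi>" \<beta>] T(3) \<beta> by auto
  next
    assume "\<phi> \<notin> T"
    with refutation \<phi> obtain f where f: "f \<in> T" "prop_implies (And f \<phi>) \<beta>" by blast
    show "Neg \<phi> \<in> T"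
    proof (rule ccontr)
      assume "Neg \<phi> \<notin> T"
      with refutation[of "Neg \<phi>"] \<phi> obtain g where g: "g \<in> T" "prop_implies (And g (Neg \<phi>)) \<beta>"
        by auto
      \<comment> \<open>Both \<open>\<phi>\<close> and its negation lead to \<open>\<beta>\<close>,
        so \<open>f\<close> and \<open>g\<close> together already imply it.\<close>
      have "\<beta> \<in> T"
        by (rule cons[OF f(1) g(1) \<beta>]) (use f(2) g(2) in \<open>auto simp: prop_implies_def\<close>)
      with T(3) show False ..
    qed
  qed
  have conj: "And \<phi> \<psi> \<in> T \<longleftrightarrow> \<phi> \<in> T \<and> \<psi> \<in> T" if "\<phi> \<in> lang M" "\<psi> \<in> lang M" for \<phi> \<psi>
    using cons[of "And \<phi> \<psi>" "And \<phi> \<psi>" \<phi>] cons[of "And \<phi> \<psi>" "And \<phi> \<psi>" \<psi>]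
      cons[of \<phi> \<psi> "And \<phi> \<psi>"] that by auto
  have disj: "Or \<phi> \<psi> \<in> T \<longleftrightarrow> \<phi> \<in> T \<or> \<psi> \<in> T" if "\<phi> \<in> lang M" "\<psi> \<in> lang M" for \<phi> \<psi>
    using cons[of \<phi> \<phi> "Or \<phi> \<psi>"] cons[of \<psi> \<psi> "Or \<phi> \<psi>"] cons[of "Or \<phi> \<psi>" "Neg \<phi>" \<psi>]
      neg that by auto
  define v where "v = {m \<in> M. Attr m \<in> T}"
  have truth: "sat v \<phi> \<longleftrightarrow> \<phi> \<in> T" if "\<phi> \<in> lang M" for \<phi>
    using that by (induction \<phi>) (auto simp: v_def neg conj disj)
  show thesis
    by (rule that[of v]) (use truth T(1,3) sub \<beta> in \<open>auto simp: v_def\<close>)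
qed

section \<open>Completeness\<close>

locale preferential_relation =
  fixes M :: "'m set" and R :: "('m compound \<times> 'm compound) set"
  assumes subset: "R \<subseteq> lang M \<times> lang M" and pref: "preferential prop_implies M R"
begin

section \<open>Derived rules of preferential consequence\<close>

lemma left_lang: "(\<phi>, \<psi>) \<in> R \<Longrightarrow> \<phi> \<in> lang M"
  and right_lang: "(\<phi>, \<psi>) \<in> R \<Longrightarrow> \<psi> \<in> lang M"
  using subset by auto

lemmas rules = pref[unfolded preferential_def prop_implies_def]

lemma refl: "\<phi> \<in> lang M \<Longrightarrow> (\<phi>, \<phi>) \<in> R"
  using rules[THEN conjunct1] by blast

lemma left_equiv:
  "(\<psi>, \<gamma>) \<in> R \<Longrightarrow> \<phi> \<in> lang M \<Longrightarrow> (\<And>v. sat v \<phi> \<longleftrightarrow> sat v \<psi>) \<Longrightarrow> (\<phi>, \<gamma>) \<in> R"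
  using rules[THEN conjunct2, THEN conjunct1] left_lang right_lang by blast

lemma right_weaken:
  "(\<phi>, \<psi>) \<in> R \<Longrightarrow> \<gamma> \<in> lang M \<Longrightarrow> (\<And>v. sat v \<psi> \<Longrightarrow> sat v \<gamma>) \<Longrightarrow> (\<phi>, \<gamma>) \<in> R"
  using rules[THEN conjunct2, THEN conjunct2, THEN conjunct1] left_lang right_lang by blast

lemma conj: "(\<phi>, \<psi>) \<in> R \<Longrightarrow> (\<phi>, \<gamma>) \<in> R \<Longrightarrow> (\<phi>, And \<psi> \<gamma>) \<in> R"
  using rules[THEN conjunct2, THEN conjunct2, THEN conjunct2, THEN conjunct1]
    left_lang right_lang by blast

lemma disj: "(\<phi>, \<gamma>) \<in> R \<Longrightarrow> (\<psi>, \<gamma>) \<in> R \<Longrightarrow> (Or \<phi> \<psi>, \<gamma>) \<in> R"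
  using rules[THEN conjunct2, THEN conjunct2, THEN conjunct2, THEN conjunct2, THEN conjunct1]
    left_lang right_lang by blast

lemma cautious_mono: "(\<phi>, \<psi>) \<in> R \<Longrightarrow> (\<phi>, \<gamma>) \<in> R \<Longrightarrow> (And \<phi> \<psi>, \<gamma>) \<in> R"
  using rules[THEN conjunct2, THEN conjunct2, THEN conjunct2, THEN conjunct2, THEN conjunct2, THEN conjunct2]
    left_lang right_lang by blast

lemma consequence:
  assumes "(\<phi>, \<psi>) \<in> R" "(\<phi>, \<chi>) \<in> R" "\<gamma> \<in> lang M"
    and "\<And>v. sat v \<psi> \<Longrightarrow> sat v \<chi> \<Longrightarrow> sat v \<gamma>"
  shows "(\<phi>, \<gamma>) \<in> R"
  by (rule right_weaken[OF conj[OF assms(1,2)] assms(3)]) (use assms(4) in simp)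

text \<open>(RW) makes \<open>\<chi>\<close> a consequence of \<open>\<phi>\<close>, and (CM) then
  replaces \<open>\<phi>\<close> by \<open>And \<phi> \<chi>\<close>, which is equivalent to
  \<open>\<chi>\<close>. This serves to pass from a disjunction to a part of it.\<close>

lemma restricted_cautious_mono:
  assumes "(\<phi>, \<psi>) \<in> R" "(\<phi>, \<gamma>) \<in> R" "\<chi> \<in> lang M"
    and "\<And>v. sat v \<chi> \<Longrightarrow> sat v \<phi>" "\<And>v. sat v \<psi> \<Longrightarrow> sat v \<chi>"
  shows "(\<chi>, \<gamma>) \<in> R"
proof -
  have "(\<phi>, \<chi>) \<in> R" by (rule right_weaken[OF assms(1,3,5)])
  from cautious_mono[OF this assms(2)] show ?thesis
    by (rule left_equiv) (use assms in auto)
qed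

text \<open>Half of a deduction theorem, from (OR): split \<open>\<phi>\<close> into
  \<open>\<psi>\<close>, which has \<open>\<gamma>\<close> as a consequence, and
  \<open>And \<phi> (Neg \<psi>)\<close>, where the conditional holds vacuously.\<close>

lemma conditionalize:
  assumes "(\<psi>, \<gamma>) \<in> R" "\<phi> \<in> lang M" and "\<And>v. sat v \<psi> \<Longrightarrow> sat v \<phi>"
  shows "(\<phi>, Or (Neg \<psi>) \<gamma>) \<in> R"
proof -
  have L: "\<psi> \<in> lang M" "\<gamma> \<in> lang M" using assms(1) subset by auto
  have "(\<psi>, Or (Neg \<psi>) \<gamma>) \<in> R"
    by (rule right_weaken[OF assms(1)]) (use L in auto)
  moreover have "(And \<phi> (Neg \<psi>), Or (Neg \<psi>) \<gamma>) \<in> R"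
    by (rule right_weaken[OF refl]) (use L assms(2) in auto)
  ultimately show ?thesis
    by (rule left_equiv[OF disj]) (use assms in auto)
qed

section \<open>The preorder of relative normality on formulae\<close>

definition le :: "'m compound \<Rightarrow> 'm compound \<Rightarrow> bool"
  where "le \<alpha> \<beta> \<longleftrightarrow> (Or \<alpha> \<beta>, \<alpha>) \<in> R"

lemma le_lang: "le \<alpha> \<beta> \<Longrightarrow> \<alpha> \<in> lang M \<and> \<beta> \<in> lang M"
  using subset by (auto simp: le_def)

text \<open>Conditionalized to the threefold disjunction, the hypotheses say that
  \<open>\<gamma>\<close> implies \<open>\<beta>\<close> and \<open>\<beta>\<close> implies
  \<open>\<alpha>\<close>; hence every disjunct leads to \<open>\<alpha>\<close>.\<close>

lemma le_chain:
  assumes "le \<alpha> \<beta>" "le \<beta> \<gamma>"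
  shows "(Or \<alpha> (Or \<beta> \<gamma>), Or (Neg \<gamma>) \<beta>) \<in> R" "(Or \<alpha> (Or \<beta> \<gamma>), \<alpha>) \<in> R"
proof -
  let ?u = "Or \<alpha> (Or \<beta> \<gamma>)"
  have L: "\<alpha> \<in> lang M" "\<beta> \<in> lang M" "\<gamma> \<in> lang M" using assms le_lang by auto
  have 1: "(?u, Or (Neg (Or \<beta> \<gamma>)) \<beta>) \<in> R" "(?u, Or (Neg (Or \<alpha> \<beta>)) \<alpha>) \<in> R"
    by (rule conditionalize; use assms L in \<open>auto simp: le_def\<close>)+
  show 2: "(?u, Or (Neg \<gamma>) \<beta>) \<in> R"
    by (rule right_weaken[OF 1(1)]) (use L in auto)
  have 3: "(?u, And ?u (Or (Neg \<gamma>) \<beta>)) \<in> R"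
    by (rule conj[OF refl 2]) (use L in auto)
  show "(?u, \<alpha>) \<in> R"
    by (rule consequence[OF 3 1(2)]) (use L in auto)
qed

lemma le_trans:
  assumes "le \<alpha> \<beta>" "le \<beta> \<gamma>"
  shows "le \<alpha> \<gamma>"
  unfolding le_def
  by (rule restricted_cautious_mono[OF le_chain(2)[OF assms] le_chain(2)[OF assms]])
    (use assms le_lang in auto)

lemma le_refl: "\<alpha> \<in> lang M \<Longrightarrow> le \<alpha> \<alpha>"
  unfolding le_def by (rule left_equiv[OF refl]) auto

text \<open>A common lower bound, used as the label of the dominating object in
  \<open>not_le_dominated\<close>.\<close>

lemma le_Or:
  assumes "\<alpha> \<in> lang M" "\<beta> \<in> lang M"
  shows "le (Or \<alpha> \<beta>) \<alpha>" "le (Or \<alpha> \<beta>) \<beta>"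
  unfolding le_def by (rule left_equiv[OF refl]; use assms in auto)+

section \<open>Valuations normal for a formula\<close>

definition normal :: "'m set \<Rightarrow> 'm compound \<Rightarrow> bool"
  where "normal v \<alpha> \<longleftrightarrow> v \<subseteq> M \<and> (\<forall>\<psi>. (\<alpha>, \<psi>) \<in> R \<longrightarrow> sat v \<psi>)"

lemma normal_sat: "normal v \<alpha> \<Longrightarrow> \<alpha> \<in> lang M \<Longrightarrow> sat v \<alpha>"
  using refl by (auto simp: normal_def)

text \<open>The threefold disjunction has as consequences that \<open>\<gamma>\<close> implies
  \<open>\<beta>\<close> and that \<open>\<beta>\<close> implies each consequence
  \<open>\<delta>\<close> of \<open>\<beta>\<close>; the resulting conditional from
  \<open>\<gamma>\<close> to \<open>\<delta>\<close> passes down to \<open>\<alpha>\<close>.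
  Transitivity of the preference and both characterizations of minimal objects rest on this.\<close>

lemma normal_transfer:
  assumes "le \<alpha> \<beta>" "le \<beta> \<gamma>" "normal v \<alpha>" "sat v \<gamma>"
  shows "normal v \<beta>"
  unfolding normal_def
proof (intro conjI allI impI)
  show "v \<subseteq> M" using assms(3) by (simp add: normal_def)
next
  fix \<delta> assume \<delta>: "(\<beta>, \<delta>) \<in> R"
  have L: "\<alpha> \<in> lang M" "\<beta> \<in> lang M" "\<gamma> \<in> lang M" "\<delta> \<in> lang M"
    using assms le_lang \<delta> subset by auto
  let ?u = "Or \<alpha> (Or \<beta> \<gamma>)"
  have "(?u, Or (Neg \<beta>) \<delta>) \<in> R"
    by (rule conditionalize[OF \<delta>]) (use L in auto)
  then have "(?u, Or (Neg \<gamma>) \<delta>) \<in> R"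
    by (rule consequence[OF le_chain(1)[OF assms(1,2)]]) (use L in auto)
  then have "(\<alpha>, Or (Neg \<gamma>) \<delta>) \<in> R"
    by (rule restricted_cautious_mono[OF le_chain(2)[OF assms(1,2)]]) (use L in auto)
  with assms(3,4) show "sat v \<delta>" by (auto simp: normal_def)
qed

text \<open>(REF), (AND) and (RW) make the consequences of \<open>\<alpha>\<close> a deductive
  theory, to which separation applies.\<close>

lemma normal_counterexample:
  assumes "\<alpha> \<in> lang M" "\<beta> \<in> lang M" "(\<alpha>, \<beta>) \<notin> R"
  obtains v where "normal v \<alpha>" "\<not> sat v \<beta>"
proof -
  have "deductive_theory M {\<psi>. (\<alpha>, \<psi>) \<in> R}"
    using subset refl[OF assms(1)] conj right_weaken
    by (auto simp: deductive_theory_def prop_implies_def)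
  then obtain v where "v \<subseteq> M" "\<And>\<phi>. \<phi> \<in> {\<psi>. (\<alpha>, \<psi>) \<in> R} \<Longrightarrow> sat v \<phi>" "\<not> sat v \<beta>"
    using deductive_theory_separation[of M _ \<beta>] assms(2,3) by blast
  then show thesis by (intro that[of v]) (auto simp: normal_def)
qed

section \<open>The canonical context\<close>

definition objects :: "('m set \<times> 'm compound) set"
  where "objects = {(v, \<alpha>). \<alpha> \<in> lang M \<and> normal v \<alpha>}"

definition incidence :: "(('m set \<times> 'm compound) \<times> 'm) set"
  where "incidence = {((v, \<alpha>), m). (v, \<alpha>) \<in> objects \<and> m \<in> v}"

text \<open>\<open>le\<close> is only a preorder; falsifying \<open>\<beta>\<close> makes the
  relation irreflexive, since a normal valuation satisfies its own label.\<close>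

definition preference :: "(('m set \<times> 'm compound) \<times> ('m set \<times> 'm compound)) set"
  where "preference = {((v, \<alpha>), (w, \<beta>)).
    (v, \<alpha>) \<in> objects \<and> (w, \<beta>) \<in> objects \<and> le \<alpha> \<beta> \<and> \<not> sat v \<beta>}"

lemma extent_objects: "extent objects incidence \<phi> = {(v, \<alpha>) \<in> objects. sat v \<phi>}"
proof -
  have "{m. ((v, \<alpha>), m) \<in> incidence} = v" if "(v, \<alpha>) \<in> objects" for v \<alpha>
    using that by (auto simp: incidence_def)
  then show ?thesis by (auto simp: extent_eq_sat)
qed

lemma preferential_context_objects: "preferential_context objects M incidence preference"
  unfolding preferential_context_def
proof (intro conjI)
  \<comment> \<open>The bound \<open>v \<subseteq> M\<close> in \<open>normal\<close> serves this
    inclusion.\<close>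
  show "incidence \<subseteq> objects \<times> M"
    by (auto simp: incidence_def objects_def normal_def)
  show "preference \<subseteq> objects \<times> objects" by (auto simp: preference_def)
  show "irrefl preference"
    using normal_sat by (auto simp: irrefl_def preference_def objects_def)
  show "trans preference"
  proof (rule transI, clarify)
    fix u \<alpha> v \<beta> w \<gamma>
    assume a: "((u, \<alpha>), (v, \<beta>)) \<in> preference" "((v, \<beta>), (w, \<gamma>)) \<in> preference"
    have "le \<alpha> \<beta>" "le \<beta> \<gamma>" "normal u \<alpha>" "\<beta> \<in> lang M" "\<not> sat u \<beta>"
      using a by (auto simp: preference_def objects_def)
    \<comment> \<open>If \<open>u\<close> satisfied \<open>\<gamma>\<close>, it would be normal for
      \<open>\<beta>\<close> by \<open>normal_transfer\<close> and so satisfy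
      \<open>\<beta>\<close>.\<close>
    then have "le \<alpha> \<gamma>" "\<not> sat u \<gamma>"
      using le_trans normal_transfer normal_sat by blast+
    then show "((u, \<alpha>), (w, \<gamma>)) \<in> preference"
      using a by (auto simp: preference_def)
  qed
qed

text \<open>A smaller object satisfying \<open>\<alpha>\<close> would be normal for
  \<open>\<beta>\<close> by \<open>normal_transfer\<close>, yet the preference makes it falsify
  \<open>\<beta>\<close>.\<close>

lemma minimalI:
  assumes "(v, \<beta>) \<in> objects" "sat v \<alpha>" "le \<beta> \<alpha>"
  shows "(v, \<beta>) \<in> minimal preference (extent objects incidence \<alpha>)"
proof -
  have False if "((w, \<gamma>), (v, \<beta>)) \<in> preference" "sat w \<alpha>" for w \<gamma>
  proof -
    from that(1) have "le \<gamma> \<beta>" "normal w \<gamma>" "\<not> sat w \<beta>" "\<beta> \<in> lang M"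
      by (auto simp: preference_def objects_def)
    then show False using normal_transfer[OF _ assms(3)] that(2) normal_sat by blast
  qed
  then show ?thesis using assms by (auto simp: minimal_def extent_objects)
qed

text \<open>Some valuation normal for \<open>Or \<beta> \<alpha>\<close> falsifies
  \<open>\<beta>\<close>, hence satisfies \<open>\<alpha>\<close>; labelled with that disjunction it
  is the required object.\<close>

lemma not_le_dominated:
  assumes "(v, \<beta>) \<in> objects" "\<alpha> \<in> lang M" "\<not> le \<beta> \<alpha>"
  obtains h where "h \<in> minimal preference (extent objects incidence \<alpha>)"
    "(h, (v, \<beta>)) \<in> preference"
proof -
  have \<beta>: "\<beta> \<in> lang M" using assms(1) by (simp add: objects_def)
  obtain w where w: "normal w (Or \<beta> \<alpha>)" "\<not> sat w \<beta>"
    using normal_counterexample[of "Or \<beta> \<alpha>" \<beta>] assms(2,3) \<beta> by (auto simp: le_def)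
  have ob: "(w, Or \<beta> \<alpha>) \<in> objects" using w(1) assms(2) \<beta> by (simp add: objects_def)
  have "sat w \<alpha>" using normal_sat[OF w(1)] w(2) assms(2) \<beta> by simp
  then have "(w, Or \<beta> \<alpha>) \<in> minimal preference (extent objects incidence \<alpha>)"
    using minimalI[OF ob] le_Or \<beta> assms(2) by blast
  moreover have "((w, Or \<beta> \<alpha>), (v, \<beta>)) \<in> preference"
    using ob assms(1,2) w(2) le_Or \<beta> by (auto simp: preference_def)
  ultimately show thesis by (rule that)
qed

lemma minimalD:
  assumes "(v, \<beta>) \<in> minimal preference (extent objects incidence \<alpha>)" "\<alpha> \<in> lang M"
  shows "normal v \<alpha>"
proof -
  have ob: "(v, \<beta>) \<in> objects" and sat: "sat v \<alpha>"
    using assms(1) by (auto simp: minimal_def extent_objects)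
  have "le \<beta> \<alpha>"
  proof (rule ccontr)
    assume "\<not> le \<beta> \<alpha>"
    from not_le_dominated[OF ob assms(2) this] show False
      using assms(1) by (auto simp: minimal_def)
  qed
  then show ?thesis
    \<comment> \<open>The chain is \<open>le \<beta> \<alpha>\<close>,
      \<open>le \<alpha> \<alpha>\<close>.\<close>
    using normal_transfer[OF _ le_refl] ob sat assms(2) by (auto simp: objects_def)
qed

text \<open>An object with label \<open>\<beta>\<close> in the extent of \<open>\<alpha>\<close> is
  minimal if \<open>le \<beta> \<alpha>\<close>, and dominated by a minimal one otherwise.\<close>

lemma smooth: "smooth objects M incidence preference"
  unfolding smooth_def
proof (intro ballI)
  fix \<alpha> g assume \<alpha>: "\<alpha> \<in> lang M" and "g \<in> extent objects incidence \<alpha>"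
  then obtain v \<beta> where g: "g = (v, \<beta>)" "(v, \<beta>) \<in> objects" "sat v \<alpha>"
    by (auto simp: extent_objects)
  then show "g \<in> minimal preference (extent objects incidence \<alpha>) \<or>
      (\<exists>h \<in> minimal preference (extent objects incidence \<alpha>). (h, g) \<in> preference)"
    using minimalI not_le_dominated[OF _ \<alpha>] by blast
qed

lemma induced_eq: "induced objects M incidence preference = R"
proof -
  have "minimal preference (extent objects incidence \<alpha>) \<subseteq> extent objects incidence \<psi>
      \<longleftrightarrow> (\<alpha>, \<psi>) \<in> R" (is "?l \<longleftrightarrow> _") if L: "\<alpha> \<in> lang M" "\<psi> \<in> lang M" for \<alpha> \<psi>
  proof
    assume ?l
    show "(\<alpha>, \<psi>) \<in> R"
    proof (rule ccontr)
      assume "(\<alpha>, \<psi>) \<notin> R"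
      then obtain v where v: "normal v \<alpha>" "\<not> sat v \<psi>"
        using normal_counterexample L by blast
      \<comment> \<open>The counterexample is labelled with \<open>\<alpha>\<close> itself, so
        reflexivity of \<open>le\<close> makes it minimal.\<close>
      then have "(v, \<alpha>) \<in> minimal preference (extent objects incidence \<alpha>)"
        using minimalI normal_sat le_refl L by (auto simp: objects_def)
      with \<open>?l\<close> v(2) show False by (auto simp: extent_objects)
    qed
  next
    assume R: "(\<alpha>, \<psi>) \<in> R"
    show ?l
    proof (clarify)
      fix v \<beta> assume min: "(v, \<beta>) \<in> minimal preference (extent objects incidence \<alpha>)"
      then have "sat v \<psi>" using minimalD[OF min L(1)] R by (auto simp: normal_def)
      with min show "(v, \<beta>) \<in> extent objects incidence \<psi>"
        by (auto simp: minimal_def extent_objects)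
    qed
  qed
  then show ?thesis using subset by (auto simp: induced_def)
qed

end

text \<open>Types cannot be quantified inside a formula: the existential uses the object type of the
  canonical context, and the second conjunct states soundness for arbitrary \<open>'g\<close> and
  both readings of implication.\<close>

theorem theorem4:
  fixes M :: "'m set" and R :: "('m compound \<times> 'm compound) set"
  assumes "R \<subseteq> lang M \<times> lang M"
  shows "(preferential prop_implies M R \<longleftrightarrow>
      (\<exists>(G :: ('m set \<times> 'm compound) set) I prec.
        preferential_context G M I prec \<and> smooth G M I prec \<and> R = induced G M I prec))
    \<and> (\<forall>(G :: 'g set) I prec.
        preferential_context G M I prec \<and> smooth G M I prec \<and> R = induced G M I prec \<longrightarrow>
        preferential prop_implies M R \<and> preferential (ctx_implies G I) M R)"
proof (intro conjI iffI)
  assume "preferential prop_implies M R"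
  with assms interpret preferential_relation M R by unfold_locales
  show "\<exists>(G :: ('m set \<times> 'm compound) set) I prec.
      preferential_context G M I prec \<and> smooth G M I prec \<and> R = induced G M I prec"
    using preferential_context_objects smooth induced_eq by blast
qed (use smooth_imp_preferential_induced smooth_imp_preferential_prop_implies in auto)

end
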